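(* For any composition $\alpha$ and any set composition $\Phi$ with $\rho(\Phi)=\alpha$, $$P_\alpha=\sum_{\sigma\in\mathfrak{S}_\Phi}\rho(P_{\sigma(\Phi)}) .$$
   Context: QSym side. A composition of $n$ is a sequence of positive integers with sum $n$; $m_i(\alpha)$ is the number of parts equal to $i$; $\alpha\le\beta$ means $\beta$ is obtained from $\alpha$ by summing groups of consecutive parts. $M_\alpha=\sum_{i_1<\cdots<i_k}x_{i_1}^{a_1}\cdots x_{i_k}^{a_k}$ is the monomial basis of $\mathrm{QSym}$ (over $\mathbb{Q}$). If $\alpha\le\beta=(b_1,\dots,b_l)$, write $\alpha$ as the concatenation $\alpha^{(1)}|\cdots|\alpha^{(l)}$ with $\alpha^{(j)}$ a composition of $b_j$; put $c_i(\alpha,\beta)!=\prod_jm_i(\alpha^{(j)})!$ and $C_{\alpha\beta}=\prod_i\frac{m_i(\alpha)!}{c_i(\alpha,\beta)!}$. $C(\alpha)$ is obtained from $\alpha=(a_1,\dots,a_k)$ by breaking it at every strict ascent $a_i<a_{i+1}$ and replacing each resulting run by its sum. Then $P_\alpha=\sum_{\alpha\le\beta\le C(\alpha)}C_{\alpha\beta}M_\beta$. NCQSym side. A set composition of $[n]$ is an ordered list $\Phi=(B_1,\dots,B_k)$ of disjoint nonempty sets with union $[n]$; $\rho(\Phi)=(|B_1|,\dots,|B_k|)$. $\mathrm{NCQSym}$ has monomial basis $(M_\Phi)$ indexed by set compositions, and $\rho:\mathrm{NCQSym}\to\mathrm{QSym}$ is the linear (Hopf) map with $\rho(M_\Phi)=M_{\rho(\Phi)}$.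 For disjoint nonempty sets, $A>_{\widetilde D}B$ iff $|A|>|B|$, or $|A|=|B|$ and $\min(A)<\min(B)$. $P_\Phi=\sum_\Psi M_\Psi$, the sum over all set compositions $\Psi$ obtained from $\Phi$ by choosing a subset $I$ of $\{i<k:B_i>_{\widetilde D}B_{i+1}\}$ and merging (by union) $B_i$ and $B_{i+1}$ into the same block for every $i\in I$. $\mathfrak{S}_\Phi=\mathfrak{S}_{\mathfrak{B}_1}\times\cdots\times\mathfrak{S}_{\mathfrak{B}_n}$, where $\mathfrak{B}_j$ is the set of blocks of $\Phi$ of size $j$: it acts on $\Phi$ by permuting the places of blocks of equal size, so $\rho(\sigma(\Phi))=\rho(\Phi)$. *)

theory Defs
  imports
    "HOL-Library.Function_Algebras"
    "HOL-Library.Poly_Mapping"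
    "HOL-Library.Disjoint_Sets"
    "HOL-Library.FuncSet"
    "HOL-Combinatorics.Permutations"
    Complex_Main
begin

section \<open>Cutting a list into runs\<close>

text \<open>
  \<open>chunks J xs\<close> cuts \<open>xs\<close> into consecutive runs: the entries at the (0-based) positions
  \<open>i\<close> and \<open>i + 1\<close> stay in the same run iff \<open>i \<in> J\<close>.
\<close>

fun chunks :: "nat set \<Rightarrow> 'a list \<Rightarrow> 'a list list" where
  "chunks J [] = []"
| "chunks J [x] = [[x]]"
| "chunks J (x # y # ys) =
     (let cs = chunks {i. Suc i \<in> J} (y # ys)
      in if 0 \<in> J then (x # hd cs) # tl cs else [x] # cs)"

lemma chunks_eq_Nil_iff [simp]: "chunks J xs = [] \<longleftrightarrow> xs = []"
  by (induction J xs rule: chunks.induct) (auto simp: Let_def)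

lemma concat_chunks [simp]: "concat (chunks J xs) = xs"
proof (induction J xs rule: chunks.induct)
  case (3 J x y ys)
  then show ?case
    by (cases "chunks {i. Suc i \<in> J} (y # ys)") (auto simp: Let_def)
qed auto

lemma Nil_notin_chunks: "[] \<notin> set (chunks J xs)"
proof (induction J xs rule: chunks.induct)
  case (3 J x y ys)
  then show ?case
    by (cases "chunks {i. Suc i \<in> J} (y # ys)") (auto simp: Let_def)
qed auto


section \<open>Compositions\<close>

definition composition_of :: "nat \<Rightarrow> nat list \<Rightarrow> bool" where
  "composition_of n \<alpha> \<longleftrightarrow> 0 \<notin> set \<alpha> \<and> sum_list \<alpha> = n"

text \<open>\<open>is_splitting \<alpha> \<beta> \<gamma>s\<close>: \<open>\<alpha>\<close> is the concatenation of \<open>\<gamma>s\<close>, whose \<open>j\<close>-th member has sum \<open>b\<^sub>j\<close>.\<close>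

definition is_splitting :: "nat list \<Rightarrow> nat list \<Rightarrow> nat list list \<Rightarrow> bool" where
  "is_splitting \<alpha> \<beta> \<gamma>s \<longleftrightarrow> concat \<gamma>s = \<alpha> \<and> [] \<notin> set \<gamma>s \<and> map sum_list \<gamma>s = \<beta>"

definition refines :: "nat list \<Rightarrow> nat list \<Rightarrow> bool" where
  "refines \<alpha> \<beta> \<longleftrightarrow> (\<exists>\<gamma>s. is_splitting \<alpha> \<beta> \<gamma>s)"

text \<open>
  For a composition \<open>\<alpha>\<close> the splitting is unique (lemma \<open>is_splitting_unique\<close> below), so that
  \<open>splitting \<alpha> \<beta>\<close> is the list of the \<open>\<alpha>\<^bsup>(j)\<^esup>\<close> whenever \<open>\<alpha> \<le> \<beta>\<close>.
\<close>

definition splitting :: "nat list \<Rightarrow> nat list \<Rightarrow> nat list list" where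
  "splitting \<alpha> \<beta> = (THE \<gamma>s. is_splitting \<alpha> \<beta> \<gamma>s)"

lemma append_eq_sum_list_eq:
  fixes as bs :: "nat list"
  assumes "as @ us = bs @ vs" "sum_list as = sum_list bs" "0 \<notin> set (as @ us)"
  shows "as = bs"
  using assms
proof (induction as arbitrary: bs)
  case Nil
  then show ?case by (cases bs) auto
next
  case (Cons a as)
  then show ?case by (cases bs) auto
qed

lemma is_splitting_unique:
  assumes "0 \<notin> set \<alpha>" "is_splitting \<alpha> \<beta> \<gamma>s" "is_splitting \<alpha> \<beta> \<delta>s"
  shows "\<gamma>s = \<delta>s"
  using assms
proof (induction \<gamma>s arbitrary: \<alpha> \<beta> \<delta>s)
  case Nil
  then show ?case by (auto simp: is_splitting_def)
next
  case (Cons c cs)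
  then obtain d ds where d: "\<delta>s = d # ds"
    by (cases \<delta>s) (auto simp: is_splitting_def)
  have eq: "c @ concat cs = d @ concat ds" "sum_list c = sum_list d"
    "0 \<notin> set (c @ concat cs)" "map sum_list cs = map sum_list ds"
    using Cons.prems d by (auto simp: is_splitting_def)
  have "c = d" using append_eq_sum_list_eq[OF eq(1-3)] .
  moreover have "cs = ds"
    by (rule Cons.IH[of "concat cs" "map sum_list cs"])
      (use Cons.prems d eq \<open>c = d\<close> in \<open>auto simp: is_splitting_def\<close>)
  ultimately show ?case using d by simp
qed

lemma splitting_eq:
  assumes "0 \<notin> set \<alpha>" "is_splitting \<alpha> \<beta> \<gamma>s"
  shows "splitting \<alpha> \<beta> = \<gamma>s"
  unfolding splitting_def using assms is_splitting_unique by blast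

definition ascent_coarsening :: "nat list \<Rightarrow> nat list" where
  "ascent_coarsening \<alpha> = map sum_list (chunks {i. Suc i < length \<alpha> \<and> \<not> \<alpha> ! i < \<alpha> ! Suc i} \<alpha>)"

text \<open>\<open>c_fact i \<alpha> \<beta>\<close> is \<open>c\<^sub>i(\<alpha>, \<beta>)!\<close>.\<close>

definition c_fact :: "nat \<Rightarrow> nat list \<Rightarrow> nat list \<Rightarrow> rat" where
  "c_fact i \<alpha> \<beta> = (\<Prod>\<gamma>\<leftarrow>splitting \<alpha> \<beta>. fact (count_list \<gamma> i))"

text \<open>All factors with \<open>i > sum_list \<alpha>\<close> are \<open>0! / 0! = 1\<close>.\<close>

definition C_coeff :: "nat list \<Rightarrow> nat list \<Rightarrow> rat" where
  "C_coeff \<alpha> \<beta> = (\<Prod>i = 1..sum_list \<alpha>. fact (count_list \<alpha> i) / c_fact i \<alpha> \<beta>)"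


section \<open>Quasisymmetric functions\<close>

text \<open>
  Commutative power series over the rationals in variables indexed by \<open>nat\<close>: a monomial is its
  exponent vector, a series is its coefficient function.  Addition is pointwise addition; the
  pointwise multiplication that \<open>Function_Algebras\<close> provides is not the product of series.
\<close>

type_synonym series = "(nat \<Rightarrow>\<^sub>0 nat) \<Rightarrow> rat"

definition scale :: "rat \<Rightarrow> series \<Rightarrow> series" where
  "scale c f = (\<lambda>m. c * f m)"

definition monomial_at :: "nat list \<Rightarrow> nat list \<Rightarrow> (nat \<Rightarrow>\<^sub>0 nat)" where
  "monomial_at is \<alpha> = (\<Sum>j<length \<alpha>. Poly_Mapping.single (is ! j) (\<alpha> ! j))"

text \<open>The coefficient of \<open>m\<close> counts the index sequences \<open>i\<^sub>1 < \<dots> < i\<^sub>k\<close> that yield \<open>m\<close>.\<close>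

definition M :: "nat list \<Rightarrow> series" where
  "M \<alpha> = (\<lambda>m. of_nat (card {is. length is = length \<alpha> \<and> sorted_wrt (<) is \<and> monomial_at is \<alpha> = m}))"

definition P :: "nat list \<Rightarrow> series" where
  "P \<alpha> = (\<Sum>\<beta> | refines \<alpha> \<beta> \<and> refines \<beta> (ascent_coarsening \<alpha>). scale (C_coeff \<alpha> \<beta>) (M \<beta>))"

lemma finite_refines: "finite {\<beta>. refines \<alpha> \<beta>}"
proof -
  have "{\<beta>. refines \<alpha> \<beta>} \<subseteq> {\<beta>. set \<beta> \<subseteq> {..sum_list \<alpha>} \<and> length \<beta> \<le> length \<alpha>}"
  proof safe
    fix \<beta> b assume "refines \<alpha> \<beta>"
    then obtain gs where g: "concat gs = \<alpha>" "[] \<notin> set gs" "\<beta> = map sum_list gs"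
      by (auto simp: refines_def is_splitting_def)
    have *: "sum_list (map sum_list gs) = sum_list (concat gs)"
      by (induction gs) auto
    show "b \<le> sum_list \<alpha>" if "b \<in> set \<beta>"
      using member_le_sum_list[OF that] g * by simp
    show "length \<beta> \<le> length \<alpha>"
      using g(2) unfolding g(1)[symmetric] g(3)
    proof (induction gs)
      case (Cons c cs)
      then show ?case by (cases c) auto
    qed simp
  qed
  then show ?thesis
    by (rule finite_subset) (rule finite_lists_length_le, simp)
qed


section \<open>Set compositions\<close>

definition set_composition_of :: "nat \<Rightarrow> nat set list \<Rightarrow> bool" where
  "set_composition_of n \<Phi> \<longleftrightarrow> distinct \<Phi> \<and> partition_on {1..n} (set \<Phi>)"

definition type_of :: "nat set list \<Rightarrow> nat list" where
  "type_of \<Phi> = map card \<Phi>"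

definition gt_D :: "nat set \<Rightarrow> nat set \<Rightarrow> bool" where
  "gt_D A B \<longleftrightarrow> card A > card B \<or> (card A = card B \<and> Min A < Min B)"

definition descents :: "nat set list \<Rightarrow> nat set" where
  "descents \<Phi> = {i. Suc i < length \<Phi> \<and> gt_D (\<Phi> ! i) (\<Phi> ! Suc i)}"

definition merge :: "nat set \<Rightarrow> nat set list \<Rightarrow> nat set list" where
  "merge I \<Phi> = map (\<lambda>Bs. \<Union>(set Bs)) (chunks I \<Phi>)"


lemma distinct_disjoint_Union_concat:
  assumes "distinct (concat gs)" "disjoint (set (concat gs))" "{} \<notin> set (concat gs)" "[] \<notin> set gs"
  shows "distinct (map (\<lambda>Bs. \<Union>(set Bs)) gs) \<and> disjoint (set (map (\<lambda>Bs. \<Union>(set Bs)) gs))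
    \<and> {} \<notin> set (map (\<lambda>Bs. \<Union>(set Bs)) gs)"
  using assms
proof (induction gs)
  case (Cons g gs)
  let ?U = "\<lambda>Bs. \<Union>(set Bs)"
  have IH: "distinct (map ?U gs) \<and> disjoint (set (map ?U gs)) \<and> {} \<notin> set (map ?U gs)"
    by (rule Cons.IH) (use Cons.prems in \<open>auto simp: disjoint_def\<close>)
  have ne: "?U g \<noteq> {}" using Cons.prems by (cases g) auto
  have "?U g \<inter> ?U h = {}" if "h \<in> set gs" for h
  proof -
    have "B \<inter> B' = {}" if "B \<in> set g" "B' \<in> set h" for B B'
    proof -
      have "B' \<in> set (concat gs)" using that \<open>h \<in> set gs\<close> by auto
      moreover have "B \<noteq> B'" using Cons.prems(1) that(1) calculation by auto
      ultimately show ?thesis using Cons.prems(2) that(1) unfolding disjoint_def by auto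
    qed
    then show ?thesis by blast
  qed
  then have "\<forall>X \<in> set (map ?U gs). ?U g \<inter> X = {}" by auto
  with IH ne show ?case
    unfolding disjoint_def by (simp del: set_map) (metis Int_absorb Int_commute)
qed auto

lemma set_composition_of_merge:
  assumes "set_composition_of n \<Phi>"
  shows "set_composition_of n (merge I \<Phi>)"
proof -
  have "\<Union>(set (merge I \<Phi>)) = \<Union>(set (concat (chunks I \<Phi>)))"
    unfolding merge_def set_concat by auto
  then show ?thesis
    using assms distinct_disjoint_Union_concat[of "chunks I \<Phi>"] Nil_notin_chunks[of I \<Phi>]
    unfolding set_composition_of_def partition_on_def merge_def by simp
qed


section \<open>Quasisymmetric functions in noncommuting variables\<close>

text \<open>
  As a vector space, \<open>NCQSym\<close> is the space with basis \<open>NM \<Phi>\<close>, \<open>\<Phi>\<close> a set composition.  It is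
  represented inside the finitely supported functions on all lists of sets, as the subspace
  of those whose support consists of set compositions.
\<close>

type_synonym nc = "nat set list \<Rightarrow>\<^sub>0 rat"

definition NCQSym :: "nc set" where
  "NCQSym = {f. \<forall>\<Phi>\<in>Poly_Mapping.keys f. \<exists>n. set_composition_of n \<Phi>}"

definition NM :: "nat set list \<Rightarrow> nc" where
  "NM \<Phi> = Poly_Mapping.single \<Phi> 1"

definition NP :: "nat set list \<Rightarrow> nc" where
  "NP \<Phi> = (\<Sum>\<Psi> \<in> (\<lambda>I. merge I \<Phi>) ` Pow (descents \<Phi>). NM \<Psi>)"

lemma NP_in_NCQSym:
  assumes "set_composition_of n \<Phi>"
  shows "NP \<Phi> \<in> NCQSym"
proof -
  have "Poly_Mapping.keys (NP \<Phi>) \<subseteq> (\<lambda>I. merge I \<Phi>) ` Pow (descents \<Phi>)"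
    unfolding NP_def NM_def by (rule order_trans[OF keys_sum]) auto
  then show ?thesis
    unfolding NCQSym_def using set_composition_of_merge[OF assms] by blast
qed

text \<open>The linear map that sends each basis vector \<open>NM \<Phi>\<close> to \<open>M (type_of \<Phi>)\<close>.\<close>

definition rho :: "nc \<Rightarrow> series" where
  "rho f = (\<Sum>\<Phi>\<in>Poly_Mapping.keys f. scale (Poly_Mapping.lookup f \<Phi>) (M (type_of \<Phi>)))"

lemma rho_superset:
  assumes "finite S" "Poly_Mapping.keys f \<subseteq> S"
  shows "rho f = (\<Sum>\<Phi>\<in>S. scale (Poly_Mapping.lookup f \<Phi>) (M (type_of \<Phi>)))"
  unfolding rho_def
  by (rule sum.mono_neutral_left)
    (use assms in \<open>auto simp: scale_def in_keys_iff zero_fun_def\<close>)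

lemma rho_add: "rho (f + g) = rho f + rho g"
proof -
  let ?S = "Poly_Mapping.keys f \<union> Poly_Mapping.keys g"
  have "scale (a + b) h = scale a h + scale b h" for a b h
    by (simp add: scale_def fun_eq_iff distrib_right)
  moreover have "Poly_Mapping.keys (f + g) \<subseteq> ?S" by (rule keys_add)
  ultimately show ?thesis
    by (simp add: rho_superset[of ?S] sum.distrib lookup_add)
qed

lemma rho_single: "rho (Poly_Mapping.single \<Phi> c) = scale c (M (type_of \<Phi>))"
  by (simp add: rho_superset[of "{\<Phi>}"])

lemma rho_NM: "rho (NM \<Phi>) = M (type_of \<Phi>)"
  by (simp add: NM_def rho_single scale_def)


section \<open>The action on set compositions\<close>

definition blocks_of_size :: "nat \<Rightarrow> nat set list \<Rightarrow> nat set set" where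
  "blocks_of_size j \<Phi> = {B \<in> set \<Phi>. card B = j}"

text \<open>
  An element of the product of the symmetric groups on the sets \<open>blocks_of_size j \<Phi>\<close> is
  a family \<open>\<sigma>\<close> of permutations, indexed by \<open>j\<close>; it puts \<open>\<sigma> (card B) B\<close> at the place of \<open>B\<close>.
\<close>

definition SG :: "nat set list \<Rightarrow> (nat \<Rightarrow> nat set \<Rightarrow> nat set) set" where
  "SG \<Phi> = (\<Pi>\<^sub>E j \<in> {1..card (\<Union>(set \<Phi>))}. {\<pi>. \<pi> permutes blocks_of_size j \<Phi>})"

definition act :: "(nat \<Rightarrow> nat set \<Rightarrow> nat set) \<Rightarrow> nat set list \<Rightarrow> nat set list" where
  "act \<sigma> \<Phi> = map (\<lambda>B. \<sigma> (card B) B) \<Phi>"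

lemma set_composition_of_act:
  assumes "set_composition_of n \<Phi>" "\<sigma> \<in> SG \<Phi>"
  shows "set_composition_of n (act \<sigma> \<Phi>)" "type_of (act \<sigma> \<Phi>) = type_of \<Phi>"
proof -
  let ?f = "\<lambda>B. \<sigma> (card B) B"
  have un: "\<Union>(set \<Phi>) = {1..n}" and ne: "{} \<notin> set \<Phi>" and d: "distinct \<Phi>"
    using assms(1) by (auto simp: set_composition_of_def partition_on_def)
  have perm: "\<sigma> (card B) permutes blocks_of_size (card B) \<Phi>" if "B \<in> set \<Phi>" for B
  proof -
    have "B \<subseteq> {1..n}" "B \<noteq> {}" using that un ne by auto
    then have "card B \<in> {1..n}"
      using card_mono[of "{1..n}" B] by (auto simp: Suc_le_eq card_gt_0_iff finite_subset)
    then show ?thesis using assms(2) un by (auto simp: SG_def PiE_iff)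
  qed
  have f: "?f B \<in> set \<Phi> \<and> card (?f B) = card B" if "B \<in> set \<Phi>" for B
    using permutes_in_image[OF perm[OF that], of B] that by (auto simp: blocks_of_size_def)
  have inj: "inj_on ?f (set \<Phi>)"
  proof (rule inj_onI)
    fix A B assume "A \<in> set \<Phi>" "B \<in> set \<Phi>" and eq: "?f A = ?f B"
    then have "card A = card B" using f by metis
    then show "A = B"
      using eq permutes_inj[OF perm[OF \<open>B \<in> set \<Phi>\<close>]] by (simp add: inj_eq)
  qed
  have "?f ` set \<Phi> = set \<Phi>"
    by (rule endo_inj_surj) (use f inj in auto)
  then show "set_composition_of n (act \<sigma> \<Phi>)"
    using assms(1) d inj by (simp add: set_composition_of_def act_def distinct_map)
  show "type_of (act \<sigma> \<Phi>) = type_of \<Phi>"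
    using f by (simp add: type_of_def act_def)
qed

end

theory Submission
  imports Defs "HOL-Combinatorics.Multiset_Permutations"
begin

text \<open>
  Let \<open>W\<close> be the set of weak descents of \<open>\<alpha>\<close>.  The compositions \<open>\<beta>\<close> between \<open>\<alpha>\<close> and \<open>C(\<alpha>)\<close> arise by merging
  along a unique subset \<open>J\<close> of \<open>W\<close>, and the term of \<open>\<rho>(P\<^bsub>\<sigma>(\<Phi>)\<^esub>)\<close> belonging to \<open>J\<close> occurs
  iff \<open>J\<close> consists of descents of \<open>\<sigma>(\<Phi>)\<close>.  As sizes weakly decrease within each run of \<open>J\<close>, that
  condition only says that, for every size \<open>j\<close> and every run, the blocks of size \<open>j\<close> in the run are
  placed by increasing minimum.  So it splits over \<open>j\<close>, and each \<open>j\<close> contributes a multinomial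
  coefficient, whose product over \<open>j\<close> is \<open>C\<^bsub>\<alpha>\<beta>\<^esub>\<close>.
\<close>

section \<open>Runs\<close>

declare chunks.simps(3) [simp del]

lemma chunks_Cons_Cons [simp]:
  "chunks J (x # y # ys) =
     (if 0 \<in> J then (x # hd (chunks {i. Suc i \<in> J} (y # ys))) # tl (chunks {i. Suc i \<in> J} (y # ys))
      else [x] # chunks {i. Suc i \<in> J} (y # ys))"
  by (simp add: chunks.simps(3) Let_def)

lemma all_nat_split: "(\<forall>i. Q i) \<longleftrightarrow> Q 0 \<and> (\<forall>i. Q (Suc i))"
  by (metis not0_implies_Suc)

lemma chunks_map: "chunks J (map f xs) = map (map f) (chunks J xs)"
proof (induction J xs rule: chunks.induct)
  case (3 J x y ys)
  then show ?case
    by (cases "chunks {i. Suc i \<in> J} (y # ys)") auto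
qed auto

text \<open>Exposes the head of the first run, so that the \<open>hd\<close> and \<open>tl\<close>
  in the recursion evaluate in the inductions below.\<close>

lemma chunks_eq_Cons:
  obtains c cs where "chunks J (x # xs) = (x # c) # cs"
proof (cases "chunks J (x # xs)")
  case (Cons d ds)
  then have "d \<noteq> []" and "concat (d # ds) = x # xs"
    using Nil_notin_chunks[of J "x # xs"] concat_chunks[of J "x # xs"] by auto
  then show ?thesis using Cons that by (cases d) auto
qed simp

text \<open>The witness is built from the front: the set for the tail is shifted by
  \<open>Suc\<close>, and \<open>0\<close> is added iff the first run has a second entry. With
  \<open>chunks_inj\<close>, sets of inner positions thus correspond bijectively to cuttings into
  nonempty runs.\<close>

lemma chunks_surj:
  assumes "[] \<notin> set gs"
  shows "\<exists>J \<subseteq> {i. Suc i < length (concat gs)}. chunks J (concat gs) = gs"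
  using assms
proof (induction "length (concat gs)" arbitrary: gs)
  case 0
  then show ?case by (cases gs) auto
next
  case (Suc n)
  then obtain x g gs' where gs: "gs = (x # g) # gs'"
    by (cases gs; cases "hd gs") auto
  show ?case
  proof (cases g)
    case Nil
    obtain J where J: "J \<subseteq> {i. Suc i < length (concat gs')}" "chunks J (concat gs') = gs'"
      using Suc.hyps(1)[of gs'] Suc.hyps(2) Suc.prems gs Nil by auto
    show ?thesis
    proof (cases "concat gs'")
      case Nil': Nil
      then have "gs' = []" using J(2) by (metis chunks.simps(1))
      then show ?thesis using gs Nil by (intro exI[of _ "{}"]) auto
    next
      case (Cons y ys)
      then show ?thesis using gs Nil J
        by (intro exI[of _ "Suc ` J"]) (auto simp: inj_image_mem_iff)
    qed
  next
    case (Cons y g')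
    obtain J where J: "J \<subseteq> {i. Suc i < length (concat (g # gs'))}"
        "chunks J (concat (g # gs')) = g # gs'"
      using Suc.hyps(1)[of "g # gs'"] Suc.hyps(2) Suc.prems gs Cons by auto
    have "{i. Suc i \<in> Suc ` J} = J" by auto
    then show ?thesis using gs Cons J
      by (intro exI[of _ "insert 0 (Suc ` J)"]) auto
  qed
qed

text \<open>The list \<open>hs\<close> groups consecutive runs of \<open>J\<close>, each group
  making up one run of \<open>K\<close>; entries joined by \<open>J\<close> are therefore joined by
  \<open>K\<close>. Positions beyond the end do not affect \<open>chunks\<close>, hence the bound on
  \<open>J\<close>. The induction removes \<open>x\<close> and has to adjust the grouping.\<close>

lemma chunks_subset_if_coarser:
  assumes "[] \<notin> set hs" "chunks J xs = concat hs" "chunks K xs = map concat hs"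
    "J \<subseteq> {i. Suc i < length xs}"
  shows "J \<subseteq> K"
  using assms
proof (induction J xs arbitrary: K hs rule: chunks.induct)
  case (3 J x y ys)
  let ?J = "{i. Suc i \<in> J}" and ?K = "{i. Suc i \<in> K}"
  obtain c cs where c: "chunks ?J (y # ys) = (y # c) # cs" by (rule chunks_eq_Cons)
  obtain d ds where d: "chunks ?K (y # ys) = (y # d) # ds" by (rule chunks_eq_Cons)
  obtain a h hs' where hs: "hs = (a # h) # hs'"
    using "3.prems"(1,2) c by (cases hs; cases "hd hs") (auto split: if_splits)
  have ne: "[] \<notin> set h"
    using "3.prems"(2) Nil_notin_chunks[of J "x # y # ys"] unfolding hs by auto
  have J: "?J \<subseteq> {i. Suc i < length (y # ys)}" using "3.prems"(4) by auto
  note IH = "3.IH"[OF _ _ _ J]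
  have "(0 \<in> J \<longrightarrow> 0 \<in> K) \<and> ?J \<subseteq> ?K"
  proof (cases "0 \<in> J")
    case J0: True
    then have a: "a = x # y # c" "cs = h @ concat hs'" using "3.prems"(2) c hs by auto
    then have K0: "0 \<in> K" using "3.prems"(3) d hs by (auto split: if_splits)
    have "?J \<subseteq> ?K"
      \<comment> \<open>Here \<open>x\<close> shares its run with \<open>y\<close>, so only the
        first run of the first group gets shorter.\<close>
      by (rule IH[of "((y # c) # h) # hs'"]) (use "3.prems" K0 a c d hs in auto)
    then show ?thesis using K0 by simp
  next
    case J0: False
    then have a: "a = [x]" "(y # c) # cs = h @ concat hs'" using "3.prems"(2) c hs by auto
    show ?thesis
    \<comment> \<open>The run \<open>[x]\<close> disappears. Its group survives as \<open>h\<close>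
      if \<open>K\<close> joins \<open>x\<close> to \<open>y\<close>; otherwise the group was
      \<open>[[x]]\<close> and disappears as well.\<close>
    proof (cases "0 \<in> K")
      case True
      then have "h \<noteq> []" using "3.prems"(3) a d hs by auto
      then have "?J \<subseteq> ?K"
        using IH[of "h # hs'"] "3.prems" True a c d hs by auto
      then show ?thesis using J0 by simp
    next
      case False
      then have "h = []" using "3.prems"(3) a d hs ne by (cases h) auto
      then have "?J \<subseteq> ?K"
        using IH[of hs'] "3.prems" False a c d hs by auto
      then show ?thesis using J0 by simp
    qed
  qed
  then have "\<forall>i. i \<in> J \<longrightarrow> i \<in> K" by (subst all_nat_split) auto
  then show ?case by blast
qed auto

lemma chunks_coarser_if_subset:
  assumes "J \<subseteq> K"
  shows "\<exists>hs. [] \<notin> set hs \<and> chunks J xs = concat hs \<and> chunks K xs = map concat hs"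
  using assms
proof (induction J xs arbitrary: K rule: chunks.induct)
  case (1 J)
  then show ?case by (auto intro: exI[of _ "[]"])
next
  case (2 J x)
  then show ?case by (auto intro: exI[of _ "[[[x]]]"])
next
  case (3 J x y ys)
  let ?J = "{i. Suc i \<in> J}" and ?K = "{i. Suc i \<in> K}"
  obtain c cs where c: "chunks ?J (y # ys) = (y # c) # cs" by (rule chunks_eq_Cons)
  obtain hs where hs: "[] \<notin> set hs" "chunks ?J (y # ys) = concat hs"
      "chunks ?K (y # ys) = map concat hs"
    using "3.IH"[of ?K] "3.prems" by auto
  obtain a h hs' where h: "hs = (a # h) # hs'"
    using hs(1,2) c by (cases hs; cases "hd hs") auto
  show ?case
  proof (cases "0 \<in> J")
    case True
    then show ?thesis using hs h "3.prems"
      by (intro exI[of _ "((x # a) # h) # hs'"]) auto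
  next
    case False
    then show ?thesis using hs h
      by (intro exI[of _ "if 0 \<in> K then ([x] # a # h) # hs' else [[x]] # hs"]) auto
  qed
qed

text \<open>With every run as a group of its own, each of the two equal cuttings is coarser than the
  other, which gives both inclusions.\<close>

lemma chunks_inj:
  assumes "chunks J xs = chunks K xs"
    and "J \<subseteq> {i. Suc i < length xs}" "K \<subseteq> {i. Suc i < length xs}"
  shows "J = K"
proof -
  define hs where "hs = map (\<lambda>c. [c]) (chunks J xs)"
  have hs: "chunks J xs = concat hs" "chunks J xs = map concat hs" "[] \<notin> set hs"
    by (auto simp: hs_def comp_def)
  have "J \<subseteq> K"
    by (rule chunks_subset_if_coarser[OF hs(3,1) _ assms(2)]) (simp add: hs(2) flip: assms(1))
  moreover have "K \<subseteq> J"
    by (rule chunks_subset_if_coarser[OF hs(3) _ hs(2) assms(3)]) (simp add: hs(1) flip: assms(1))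
  ultimately show ?thesis by simp
qed

text \<open>The positions in \<open>J\<close> are exactly the adjacent pairs lying within a run. The
  relation is kept general because it is applied both to sizes with \<open>\<ge>\<close> and to
  blocks with \<open>gt_D\<close>.\<close>

lemma subset_positions_iff_successively:
  assumes "J \<subseteq> {i. Suc i < length xs}"
  shows "J \<subseteq> {i. Suc i < length xs \<and> R (xs ! i) (xs ! Suc i)} \<longleftrightarrow>
    (\<forall>c\<in>set (chunks J xs). successively R c)"
  using assms
proof (induction J xs rule: chunks.induct)
  case (3 J x y ys)
  let ?J = "{i. Suc i \<in> J}"
  obtain c cs where c: "chunks ?J (y # ys) = (y # c) # cs" by (rule chunks_eq_Cons)
  have "?J \<subseteq> {i. Suc i < length (y # ys)}" using "3.prems" by auto
  note IH = "3.IH"[OF this]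
  define A where "A = {i. Suc i < length (x # y # ys) \<and> R ((x # y # ys) ! i) ((x # y # ys) ! Suc i)}"
  define B where "B = {i. Suc i < length (y # ys) \<and> R ((y # ys) ! i) ((y # ys) ! Suc i)}"
  have "J \<subseteq> A \<longleftrightarrow> (0 \<in> J \<longrightarrow> 0 \<in> A) \<and> (\<forall>i. Suc i \<in> J \<longrightarrow> Suc i \<in> A)"
    unfolding subset_iff by (rule all_nat_split)
  also have "\<dots> \<longleftrightarrow> (0 \<in> J \<longrightarrow> R x y) \<and> ?J \<subseteq> B"
    by (auto simp: A_def B_def)
  also have "?J \<subseteq> B \<longleftrightarrow> (\<forall>c\<in>set (chunks ?J (y # ys)). successively R c)"
    unfolding B_def by (rule IH)
  finally show ?case unfolding A_def c using c by auto
qed auto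


section \<open>Coarsenings of a composition\<close>

lemma is_splitting_chunks: "is_splitting \<alpha> (map sum_list (chunks J \<alpha>)) (chunks J \<alpha>)"
  by (simp add: is_splitting_def Nil_notin_chunks)

text \<open>As the parts are positive, the sums of the runs determine the runs, and these determine
  the set of joined positions.\<close>

lemma sum_list_chunks_inj:
  fixes \<alpha> :: "nat list"
  assumes "0 \<notin> set \<alpha>" "map sum_list (chunks J \<alpha>) = map sum_list (chunks K \<alpha>)"
    and "J \<subseteq> {i. Suc i < length \<alpha>}" "K \<subseteq> {i. Suc i < length \<alpha>}"
  shows "J = K"
proof -
  have "is_splitting \<alpha> (map sum_list (chunks J \<alpha>)) (chunks K \<alpha>)"
    unfolding assms(2) by (rule is_splitting_chunks)
  from is_splitting_unique[OF assms(1) is_splitting_chunks this] show ?thesis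
    using assms(3,4) by (rule chunks_inj)
qed

lemma sum_list_concat: "sum_list (concat xss) = sum_list (map sum_list xss)"
  for xss :: "'a::monoid_add list list"
  by (induction xss) auto

text \<open>Lifts a grouping of the sums of runs to a grouping of the runs themselves.\<close>

lemma map_eq_concat:
  assumes "map f xs = concat yss"
  shows "\<exists>xss. xs = concat xss \<and> yss = map (map f) xss"
  using assms
proof (induction yss arbitrary: xs)
  case (Cons ys yss)
  then obtain us vs where "xs = us @ vs" "map f us = ys" "map f vs = concat yss"
    by (auto simp: map_eq_append_conv)
  with Cons.IH obtain xss where "vs = concat xss" "yss = map (map f) xss" by blast
  then show ?case using \<open>xs = us @ vs\<close> \<open>map f us = ys\<close> by (intro exI[of _ "us # xss"]) auto
qed auto

lemma concat_map_concat: "concat (map concat xsss) = concat (concat xsss)"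
  by (induction xsss) auto

text \<open>Turns refinement of coarsenings into inclusion of sets. For the forward direction, the
  grouping of sums is lifted to runs; joining each group splits \<open>\<alpha>\<close> with the
  sums prescribed by \<open>K\<close>, so uniqueness of splittings identifies the joined groups with
  the runs of \<open>K\<close>.\<close>

lemma refines_chunks_iff:
  assumes "0 \<notin> set \<alpha>" "J \<subseteq> {i. Suc i < length \<alpha>}"
  shows "refines (map sum_list (chunks J \<alpha>)) (map sum_list (chunks K \<alpha>)) \<longleftrightarrow> J \<subseteq> K"
proof
  assume "refines (map sum_list (chunks J \<alpha>)) (map sum_list (chunks K \<alpha>))"
  then obtain gs where gs: "concat gs = map sum_list (chunks J \<alpha>)" "[] \<notin> set gs"
      "map sum_list gs = map sum_list (chunks K \<alpha>)"
    by (auto simp: refines_def is_splitting_def)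
  obtain hs where hs: "chunks J \<alpha> = concat hs" "gs = map (map sum_list) hs"
    using map_eq_concat[OF gs(1)[symmetric]] by auto
  have ne: "[] \<notin> set hs" using gs(2) hs(2) by auto
  have "concat (map concat hs) = \<alpha>"
    using concat_chunks[of J \<alpha>] unfolding hs(1) by (simp add: concat_map_concat)
  moreover have "[] \<notin> set (map concat hs)"
  proof
    assume "[] \<in> set (map concat hs)"
    then obtain h where h: "h \<in> set hs" "concat h = []" by auto
    have "h \<noteq> []" using h(1) ne by metis
    then have "[] \<in> set h" using h(2) by (cases h) auto
    then show False using h Nil_notin_chunks[of J \<alpha>] unfolding hs(1) by auto
  qed
  moreover have "map sum_list (map concat hs) = map sum_list (chunks K \<alpha>)"
    using gs(3) unfolding hs(2) by (simp add: sum_list_concat comp_def)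
  ultimately have "is_splitting \<alpha> (map sum_list (chunks K \<alpha>)) (map concat hs)"
    by (simp add: is_splitting_def)
  then have "chunks K \<alpha> = map concat hs"
    using is_splitting_unique[OF assms(1) is_splitting_chunks] by blast
  then show "J \<subseteq> K" using chunks_subset_if_coarser ne hs(1) assms(2) by blast
next
  assume "J \<subseteq> K"
  then obtain hs where hs: "[] \<notin> set hs" "chunks J \<alpha> = concat hs" "chunks K \<alpha> = map concat hs"
    using chunks_coarser_if_subset by blast
  then have "is_splitting (map sum_list (chunks J \<alpha>)) (map sum_list (chunks K \<alpha>))
      (map (map sum_list) hs)"
    by (auto simp: is_splitting_def map_concat sum_list_concat)
  then show "refines (map sum_list (chunks J \<alpha>)) (map sum_list (chunks K \<alpha>))"
    by (auto simp: refines_def)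
qed

definition weak_descents :: "nat list \<Rightarrow> nat set" where
  "weak_descents \<alpha> = {i. Suc i < length \<alpha> \<and> \<alpha> ! Suc i \<le> \<alpha> ! i}"

lemma coarsenings_eq:
  assumes "0 \<notin> set \<alpha>"
  shows "{\<beta>. refines \<alpha> \<beta> \<and> refines \<beta> (ascent_coarsening \<alpha>)} =
    (\<lambda>J. map sum_list (chunks J \<alpha>)) ` Pow (weak_descents \<alpha>)" (is "?L = ?R")
proof
  \<comment> \<open>Breaking at strict ascents is joining at weak descents, so the upper bound of
    the interval is itself of the form handled by \<open>refines_chunks_iff\<close>.\<close>
  have C: "ascent_coarsening \<alpha> = map sum_list (chunks (weak_descents \<alpha>) \<alpha>)"
    by (simp add: ascent_coarsening_def weak_descents_def not_less)
  show "?L \<subseteq> ?R"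
  proof clarify
    fix \<beta> assume r: "refines \<alpha> \<beta>" "refines \<beta> (ascent_coarsening \<alpha>)"
    then obtain gs where gs: "\<alpha> = concat gs" "[] \<notin> set gs" "\<beta> = map sum_list gs"
      by (auto simp: refines_def is_splitting_def)
    then obtain J where J: "J \<subseteq> {i. Suc i < length \<alpha>}" "chunks J \<alpha> = gs"
      using chunks_surj by blast
    then have "J \<subseteq> weak_descents \<alpha>"
      using r(2) gs(3) refines_chunks_iff[OF assms J(1)] unfolding C by simp
    then show "\<beta> \<in> ?R" using gs(3) J(2) by (intro image_eqI[of _ _ J]) auto
  qed
  show "?R \<subseteq> ?L"
  proof clarify
    fix J assume J: "J \<subseteq> weak_descents \<alpha>"
    then have "J \<subseteq> {i. Suc i < length \<alpha>}" by (auto simp: weak_descents_def)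
    from refines_chunks_iff[OF assms this, of "weak_descents \<alpha>"] J
    have "refines (map sum_list (chunks J \<alpha>)) (ascent_coarsening \<alpha>)"
      unfolding C by simp
    moreover have "refines \<alpha> (map sum_list (chunks J \<alpha>))"
      using is_splitting_chunks unfolding refines_def by blast
    ultimately show "refines \<alpha> (map sum_list (chunks J \<alpha>)) \<and>
        refines (map sum_list (chunks J \<alpha>)) (ascent_coarsening \<alpha>)" by simp
  qed
qed

lemma P_eq_sum_weak_descents:
  assumes "0 \<notin> set \<alpha>"
  shows "P \<alpha> = (\<Sum>J \<in> Pow (weak_descents \<alpha>).
    scale (C_coeff \<alpha> (map sum_list (chunks J \<alpha>))) (M (map sum_list (chunks J \<alpha>))))"
proof -
  have "inj_on (\<lambda>J. map sum_list (chunks J \<alpha>)) (Pow (weak_descents \<alpha>))"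
  proof (rule inj_onI)
    fix J K assume JK: "J \<in> Pow (weak_descents \<alpha>)" "K \<in> Pow (weak_descents \<alpha>)"
      "map sum_list (chunks J \<alpha>) = map sum_list (chunks K \<alpha>)"
    show "J = K"
      by (rule sum_list_chunks_inj[OF assms JK(3)]) (use JK in \<open>auto simp: weak_descents_def\<close>)
  qed
  then show ?thesis
    unfolding P_def coarsenings_eq[OF assms] by (simp only: sum.reindex comp_def)
qed


section \<open>Images of the bases of NCQSym\<close>

lemma set_compositionD:
  assumes "set_composition_of n \<Phi>"
  shows "distinct \<Phi>" "disjoint (set \<Phi>)" "\<Union>(set \<Phi>) = {1..n}"
    "\<And>B. B \<in> set \<Phi> \<Longrightarrow> finite B" "\<And>B. B \<in> set \<Phi> \<Longrightarrow> B \<noteq> {}"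
    "\<And>B. B \<in> set \<Phi> \<Longrightarrow> card B \<in> {1..n}"
proof -
  show d: "distinct \<Phi>" "disjoint (set \<Phi>)" and u: "\<Union>(set \<Phi>) = {1..n}"
    and ne: "\<And>B. B \<in> set \<Phi> \<Longrightarrow> B \<noteq> {}"
    using assms by (auto simp: set_composition_of_def partition_on_def)
  have sub: "B \<subseteq> {1..n}" if "B \<in> set \<Phi>" for B using that u by auto
  then show fin: "\<And>B. B \<in> set \<Phi> \<Longrightarrow> finite B" using finite_subset by blast
  show "card B \<in> {1..n}" if "B \<in> set \<Phi>" for B
    using card_mono[OF _ sub[OF that]] fin[OF that] ne[OF that]
    by (auto simp: Suc_le_eq card_gt_0_iff)
qed

lemma card_Union_eq_sum_list:
  assumes "distinct c" "disjoint (set c)" "\<And>B. B \<in> set c \<Longrightarrow> finite B"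
  shows "card (\<Union>(set c)) = sum_list (map card c)"
proof -
  have "pairwise disjnt (set c)"
    using assms(2) by (auto simp: disjoint_def pairwise_def disjnt_def)
  then show ?thesis
    using assms(1,3) by (subst card_Union_disjoint) (auto simp: sum_list_distinct_conv_sum_set)
qed

lemma type_of_merge:
  assumes "set_composition_of n \<Phi>"
  shows "type_of (merge I \<Phi>) = map sum_list (chunks I (type_of \<Phi>))"
proof -
  note \<Phi> = set_compositionD[OF assms]
  have "card (\<Union>(set c)) = sum_list (map card c)" if c: "c \<in> set (chunks I \<Phi>)" for c
  proof -
    have sub: "set c \<subseteq> set \<Phi>" using c concat_chunks[of I \<Phi>] by (metis UN_upper set_concat)
    have "distinct (concat (chunks I \<Phi>))" using \<Phi>(1) by simp
    then have "distinct c" using c distinct_concat_iff[of "chunks I \<Phi>"] by blast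
    moreover have "disjoint (set c)" using \<Phi>(2) sub by (auto simp: disjoint_def)
    ultimately show ?thesis using \<Phi>(4) sub by (intro card_Union_eq_sum_list) auto
  qed
  then show ?thesis by (simp add: type_of_def merge_def chunks_map)
qed

lemma zero_notin_type_of:
  assumes "set_composition_of n \<Phi>"
  shows "0 \<notin> set (type_of \<Phi>)"
  using set_compositionD(6)[OF assms] by (force simp: type_of_def)

lemma descents_subset: "descents \<Phi> \<subseteq> weak_descents (type_of \<Phi>)"
  by (auto simp: descents_def weak_descents_def gt_D_def type_of_def)

lemma rho_sum: "rho (sum f A) = (\<Sum>x\<in>A. rho (f x))"
proof (induction A rule: infinite_finite_induct)
qed (auto simp: rho_add, auto simp: rho_def)

text \<open>\<open>NP\<close> sums over the set of merged compositions, so indexing by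
  \<open>I\<close> requires that different \<open>I\<close> give different merges. Already their
  types differ.\<close>

lemma rho_NP:
  assumes "set_composition_of n \<Phi>"
  shows "rho (NP \<Phi>) = (\<Sum>I \<in> Pow (descents \<Phi>). M (map sum_list (chunks I (type_of \<Phi>))))"
proof -
  have "inj_on (\<lambda>I. merge I \<Phi>) (Pow (descents \<Phi>))"
  proof (rule inj_onI)
    fix I J assume IJ: "I \<in> Pow (descents \<Phi>)" "J \<in> Pow (descents \<Phi>)" "merge I \<Phi> = merge J \<Phi>"
    show "I = J"
    proof (rule sum_list_chunks_inj[OF zero_notin_type_of[OF assms]])
      show "map sum_list (chunks I (type_of \<Phi>)) = map sum_list (chunks J (type_of \<Phi>))"
        using IJ(3) type_of_merge[OF assms] by metis
    qed (use IJ in \<open>auto simp: descents_def type_of_def\<close>)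
  qed
  then have "NP \<Phi> = (\<Sum>I \<in> Pow (descents \<Phi>). NM (merge I \<Phi>))"
    unfolding NP_def by (simp only: sum.reindex comp_def)
  then show ?thesis
    by (simp only: rho_sum rho_NM type_of_merge[OF assms])
qed


section \<open>Counting block-wise increasing permutations\<close>

fun incr_pieces :: "nat list \<Rightarrow> 'a::linorder list \<Rightarrow> bool" where
  "incr_pieces [] xs \<longleftrightarrow> xs = []"
| "incr_pieces (k # ks) xs \<longleftrightarrow>
     k \<le> length xs \<and> sorted_wrt (<) (take k xs) \<and> incr_pieces ks (drop k xs)"

lemma incr_pieces_map_concat:
  "incr_pieces (map length gs) (map f (concat gs)) \<longleftrightarrow>
    (\<forall>g\<in>set gs. sorted_wrt (\<lambda>x y. f x < f y) g)"
  by (induction gs) (auto simp: sorted_wrt_map)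

text \<open>The multinomial coefficient, stated as a product to stay within the naturals. An
  increasing first piece is determined by its set of \<open>k\<close> entries, which leaves an
  arrangement of the remaining entries.\<close>

lemma card_incr_pieces:
  fixes S :: "'a::linorder set"
  assumes "finite S" "sum_list ks = card S"
  shows "card {xs \<in> permutations_of_set S. incr_pieces ks xs} * (\<Prod>k\<leftarrow>ks. fact k) = (fact (card S) :: nat)"
  using assms
proof (induction ks arbitrary: S)
  case Nil
  then have "{xs \<in> permutations_of_set S. incr_pieces [] xs} = {[]}"
    by (auto simp: permutations_of_set_def)
  then show ?case using Nil by simp
next
  case (Cons k ks)
  let ?T = "\<lambda>S. {xs \<in> permutations_of_set S. incr_pieces ks xs}"
  let ?D = "{A. A \<subseteq> S \<and> card A = k}"
  let ?f = "\<lambda>(A, ys). sorted_list_of_set A @ ys"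
  have fin: "finite A" if "A \<in> ?D" for A
    using that finite_subset[OF _ Cons.prems(1)] by blast
  have "bij_betw ?f (SIGMA A:?D. ?T (S - A)) {xs \<in> permutations_of_set S. incr_pieces (k # ks) xs}"
  proof (rule bij_betwI[where g = "\<lambda>xs. (set (take k xs), drop k xs)"], goal_cases)
    case 1
    show ?case
    proof (rule Pi_I)
      fix p assume "p \<in> (SIGMA A:?D. ?T (S - A))"
      then obtain A ys where p: "p = (A, ys)" and A: "A \<subseteq> S" "card A = k"
        and ys: "ys \<in> permutations_of_set (S - A)" "incr_pieces ks ys" by blast
      have "finite A" by (rule finite_subset[OF A(1) Cons.prems(1)])
      then show "?f p \<in> {xs \<in> permutations_of_set S. incr_pieces (k # ks) xs}"
        using A ys by (auto simp: p permutations_of_set_def)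
    qed
  next
    case 2
    show ?case
    proof (rule Pi_I)
      fix xs assume "xs \<in> {xs \<in> permutations_of_set S. incr_pieces (k # ks) xs}"
      then have xs: "distinct xs" "set xs = S" "k \<le> length xs" "incr_pieces ks (drop k xs)"
        by (auto simp: permutations_of_set_def)
      have td: "distinct (take k xs @ drop k xs)" "set (take k xs @ drop k xs) = S"
        using xs by simp_all
      have "set (take k xs) \<subseteq> S" using set_take_subset[of k xs] xs(2) by simp
      moreover have "card (set (take k xs)) = k" using xs by (simp add: distinct_card)
      moreover have "drop k xs \<in> permutations_of_set (S - set (take k xs))"
        using td by (auto simp: permutations_of_set_def simp del: append_take_drop_id)
      ultimately show "(set (take k xs), drop k xs) \<in> (SIGMA A:?D. ?T (S - A))"
        using xs(4) by simp
    qed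
  next
    case (3 p)
    then obtain A ys where p: "p = (A, ys)" and A: "A \<subseteq> S" "card A = k" by blast
    have "finite A" by (rule finite_subset[OF A(1) Cons.prems(1)])
    then show ?case using A(2) by (simp add: p)
  next
    case (4 xs)
    then have "sorted_wrt (<) (take k xs)" by simp
    then have "sorted_list_of_set (set (take k xs)) = take k xs"
      by (simp only: strict_sorted_iff sorted_list_of_set.idem_if_sorted_distinct)
    then show ?case by simp
  qed
  from bij_betw_same_card[OF this, symmetric]
  have "card {xs \<in> permutations_of_set S. incr_pieces (k # ks) xs} = (\<Sum>A\<in>?D. card (?T (S - A)))"
    using Cons.prems(1) by simp
  moreover have "card (?T (S - A)) * (\<Prod>k\<leftarrow>ks. fact k) = fact (card S - k)" if "A \<in> ?D" for A
    using that Cons.IH[of "S - A"] Cons.prems fin[OF that] by (auto simp: card_Diff_subset)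
  ultimately have "card {xs \<in> permutations_of_set S. incr_pieces (k # ks) xs} * (\<Prod>k\<leftarrow>ks. fact k)
      = (card S choose k) * fact (card S - k)"
    by (simp add: sum_distrib_right n_subsets[OF Cons.prems(1)])
  then show ?case
    using binomial_fact_lemma[of k "card S"] Cons.prems(2) by (simp add: algebra_simps)
qed

text \<open>Listing the keys of the images along \<open>concat gs\<close> turns permutations of the
  set into arrangements of its keys, and the condition on the members of \<open>gs\<close> into that
  of increasing pieces.\<close>

lemma card_permutes_incr:
  fixes key :: "'a \<Rightarrow> 'b::linorder"
  assumes "distinct (concat gs)" "inj_on key (set (concat gs))"
  shows "card {\<pi>. \<pi> permutes set (concat gs) \<and>
      (\<forall>g\<in>set gs. sorted_wrt (\<lambda>x y. key (\<pi> x) < key (\<pi> y)) g)} * (\<Prod>g\<leftarrow>gs. fact (length g))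
    = fact (length (concat gs))"
proof -
  define xs where "xs = concat gs"
  define S where "S = set xs"
  define F where "F = (\<lambda>\<pi>. map (\<lambda>x. key (\<pi> x)) xs)"
  have "distinct xs" "inj_on key S" using assms by (simp_all add: S_def xs_def)
  then have S: "finite S" "inj_on key S" "card S = length xs" "distinct xs" "card (key ` S) = length xs"
    by (simp_all add: S_def distinct_card card_image)
  have inj: "inj_on F {\<pi>. \<pi> permutes S}"
  proof (rule inj_onI, rule ext)
    fix \<pi> \<tau> x assume "\<pi> \<in> {\<pi>. \<pi> permutes S}" "\<tau> \<in> {\<pi>. \<pi> permutes S}" and F: "F \<pi> = F \<tau>"
    then have p: "\<pi> permutes S" "\<tau> permutes S" by auto
    show "\<pi> x = \<tau> x"
    proof (cases "x \<in> S")
      case True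
      then have "key (\<pi> x) = key (\<tau> x)" using F by (simp add: F_def S_def)
      then show ?thesis using S(2) True p by (auto simp: inj_on_def permutes_in_image)
    next
      case False
      then show ?thesis using p by (simp add: permutes_not_in)
    qed
  qed
  have "F \<pi> \<in> permutations_of_set (key ` S)" if p: "\<pi> permutes S" for \<pi>
  proof -
    have "set (F \<pi>) = key ` (\<pi> ` S)" by (auto simp: F_def S_def)
    then have "set (F \<pi>) = key ` S" by (simp only: permutes_image[OF p])
    moreover have "inj_on (\<lambda>x. key (\<pi> x)) S"
      using S(2) permutes_inj_on[OF p, of S] permutes_image[OF p]
      by (auto intro: comp_inj_on[of \<pi> S key, unfolded comp_def])
    then have "distinct (F \<pi>)" using S(4) by (simp add: F_def distinct_map S_def)
    ultimately show ?thesis by (simp add: permutations_of_set_def)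
  qed
  \<comment> \<open>Surjectivity of \<open>F\<close> comes from counting: it is injective, and both
    sides have as many elements as the factorial of \<open>length xs\<close>.\<close>
  moreover have "card (F ` {\<pi>. \<pi> permutes S}) = card (permutations_of_set (key ` S))"
    using S by (simp add: card_image[OF inj] card_permutations[of S "length xs"])
  ultimately have im: "F ` {\<pi>. \<pi> permutes S} = permutations_of_set (key ` S)"
    by (intro card_subset_eq) auto
  have incr: "incr_pieces (map length gs) (F \<pi>) \<longleftrightarrow>
      (\<forall>g\<in>set gs. sorted_wrt (\<lambda>x y. key (\<pi> x) < key (\<pi> y)) g)" for \<pi>
    unfolding F_def xs_def by (rule incr_pieces_map_concat)
  let ?A = "{\<pi>. \<pi> permutes S \<and> incr_pieces (map length gs) (F \<pi>)}"
  have "F ` ?A = {ys \<in> permutations_of_set (key ` S). incr_pieces (map length gs) ys}"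
    unfolding im[symmetric] by auto
  moreover have "card (F ` ?A) = card ?A"
    by (rule card_image, rule inj_on_subset[OF inj]) auto
  moreover have "sum_list (map length gs) = card (key ` S)"
    unfolding S(5) by (simp add: xs_def length_concat)
  ultimately have "card ?A * (\<Prod>k\<leftarrow>map length gs. fact k) = fact (length xs)"
    using card_incr_pieces[of "key ` S" "map length gs"] S(1,5) by simp
  then show ?thesis
    unfolding incr map_map comp_def S_def xs_def .
qed


section \<open>Counting the elements of the group\<close>

text \<open>Since \<open>\<sigma>\<close> preserves sizes and these weakly decrease along
  \<open>c\<close>, two blocks of different size are always in the right order. Only pairs of equal
  size impose a condition, and it compares minima.\<close>

lemma sorted_wrt_gt_D_map_iff:
  assumes "sorted_wrt (\<ge>) (map card c)" "\<And>B. B \<in> set c \<Longrightarrow> card (\<sigma> (card B) B) = card B"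
  shows "sorted_wrt gt_D (map (\<lambda>B. \<sigma> (card B) B) c) \<longleftrightarrow>
    (\<forall>j. sorted_wrt (\<lambda>A B. Min (\<sigma> j A) < Min (\<sigma> j B)) (filter (\<lambda>B. card B = j) c))"
  using assms
proof (induction c)
  case (Cons A c)
  have "(\<forall>B\<in>set c. gt_D (\<sigma> (card A) A) (\<sigma> (card B) B)) \<longleftrightarrow>
    (\<forall>B\<in>set c. card B = card A \<longrightarrow> Min (\<sigma> (card A) A) < Min (\<sigma> (card A) B))"
    using Cons.prems by (fastforce simp: gt_D_def)
  then show ?case using Cons by auto
qed auto

text \<open>Transitivity allows the comparison of adjacent blocks in a run to be replaced by that of
  all pairs, which can then be sorted by size.\<close>

lemma transp_gt_D: "transp gt_D"
  by (auto simp: transp_def gt_D_def)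

text \<open>For each \<open>j\<close> the right-hand side involves only the component
  \<open>\<sigma> j\<close>; this independence makes the count a product.\<close>

lemma subset_descents_act_iff:
  assumes "set_composition_of n \<Phi>" "\<sigma> \<in> SG \<Phi>" "I \<subseteq> weak_descents (type_of \<Phi>)"
  shows "I \<subseteq> descents (act \<sigma> \<Phi>) \<longleftrightarrow> (\<forall>j. \<forall>g\<in>set (map (filter (\<lambda>B. card B = j)) (chunks I \<Phi>)).
    sorted_wrt (\<lambda>A B. Min (\<sigma> j A) < Min (\<sigma> j B)) g)"
proof -
  have len: "length (act \<sigma> \<Phi>) = length \<Phi>" "length (type_of \<Phi>) = length \<Phi>"
    by (simp_all add: act_def type_of_def)
  have I: "I \<subseteq> {i. Suc i < length \<Phi>}" using assms(3) by (auto simp: weak_descents_def len)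
  have card_eq: "card (\<sigma> (card B) B) = card B" if "B \<in> set \<Phi>" for B
    using set_composition_of_act(2)[OF assms(1,2)] that by (simp add: type_of_def act_def)
  have sub: "set c \<subseteq> set \<Phi>" if "c \<in> set (chunks I \<Phi>)" for c
    using that concat_chunks[of I \<Phi>] by (metis UN_upper set_concat)
  have "\<forall>c\<in>set (chunks I (type_of \<Phi>)). successively (\<ge>) c"
    using assms(3) subset_positions_iff_successively[of I "type_of \<Phi>" "(\<ge>)"] I
    by (simp add: weak_descents_def len)
  then have dec: "sorted_wrt (\<ge>) (map card c)" if "c \<in> set (chunks I \<Phi>)" for c
    using that by (simp add: type_of_def chunks_map successively_conv_sorted_wrt)
  have "I \<subseteq> descents (act \<sigma> \<Phi>) \<longleftrightarrow> (\<forall>c\<in>set (chunks I (act \<sigma> \<Phi>)). sorted_wrt gt_D c)"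
    unfolding descents_def
    using subset_positions_iff_successively[of I "act \<sigma> \<Phi>" gt_D] I
    by (simp add: len successively_conv_sorted_wrt transp_gt_D)
  also have "\<dots> \<longleftrightarrow> (\<forall>c\<in>set (chunks I \<Phi>). sorted_wrt gt_D (map (\<lambda>B. \<sigma> (card B) B) c))"
    by (simp add: act_def chunks_map)
  also have "\<dots> \<longleftrightarrow> (\<forall>c\<in>set (chunks I \<Phi>). \<forall>j.
      sorted_wrt (\<lambda>A B. Min (\<sigma> j A) < Min (\<sigma> j B)) (filter (\<lambda>B. card B = j) c))"
    by (rule ball_cong[OF refl], rule sorted_wrt_gt_D_map_iff[where \<sigma> = \<sigma>, OF dec card_eq]) (use sub in auto)
  finally show ?thesis by auto
qed

lemma card_SG_descents:
  assumes "set_composition_of n \<Phi>" "I \<subseteq> weak_descents (type_of \<Phi>)"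
  shows "of_nat (card {\<sigma> \<in> SG \<Phi>. I \<subseteq> descents (act \<sigma> \<Phi>)}) =
    C_coeff (type_of \<Phi>) (map sum_list (chunks I (type_of \<Phi>)))"
proof -
  note \<Phi> = set_compositionD[OF assms(1)]
  define gs where "gs j = map (filter (\<lambda>B. card B = j)) (chunks I \<Phi>)" for j
  define Q where "Q j = {\<pi>. \<pi> permutes blocks_of_size j \<Phi> \<and>
    (\<forall>g\<in>set (gs j). sorted_wrt (\<lambda>A B. Min (\<pi> A) < Min (\<pi> B)) g)}" for j
  have concat_gs: "concat (gs j) = filter (\<lambda>B. card B = j) \<Phi>" for j
    by (simp add: gs_def flip: filter_concat)
  then have set_gs: "set (concat (gs j)) = blocks_of_size j \<Phi>" for j
    by (auto simp: blocks_of_size_def)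
  \<comment> \<open>No block has a size outside \<open>{1..n}\<close>, so the condition for all
    \<open>j\<close> reduces to the indices of the product \<open>SG\<close>.\<close>
  have trivial: "g = []" if "g \<in> set (gs j)" "j \<notin> {1..n}" for g j
  proof -
    have "concat (gs j) = []" using that(2) \<Phi>(6) by (force simp: concat_gs filter_empty_conv)
    then show ?thesis using that(1) by simp
  qed
  have "{\<sigma> \<in> SG \<Phi>. I \<subseteq> descents (act \<sigma> \<Phi>)} =
    {\<sigma> \<in> SG \<Phi>. \<forall>j\<in>{1..n}. \<forall>g\<in>set (gs j). sorted_wrt (\<lambda>A B. Min (\<sigma> j A) < Min (\<sigma> j B)) g}"
    using subset_descents_act_iff[OF assms(1) _ assms(2)] trivial unfolding gs_def[symmetric]
    by (intro Collect_cong) (metis sorted_wrt.simps(1))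
  also have "\<dots> = PiE {1..n} Q"
    unfolding SG_def \<Phi>(3) Q_def by (auto simp: PiE_iff extensional_def)
  finally have "card {\<sigma> \<in> SG \<Phi>. I \<subseteq> descents (act \<sigma> \<Phi>)} = (\<Prod>j = 1..n. card (Q j))"
    by (simp add: card_PiE)
  moreover have "of_nat (card (Q j)) = (fact (count_list (type_of \<Phi>) j) /
      c_fact j (type_of \<Phi>) (map sum_list (chunks I (type_of \<Phi>))) :: rat)" for j
  proof -
    have cnt: "count_list (map card c) j = length (filter (\<lambda>B. card B = j) c)" for c :: "nat set list"
      by (induction c) auto
    \<comment> \<open>Disjoint nonempty blocks have different minima, so \<open>Min\<close> can
      serve as the injective key.\<close>
    have "Min A \<noteq> Min B" if "A \<in> set \<Phi>" "B \<in> set \<Phi>" "A \<noteq> B" for A B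
      using that \<Phi>(2,4,5) Min_in[of A] Min_in[of B] unfolding disjoint_def
      by (metis disjoint_iff)
    then have "inj_on Min (set (concat (gs j)))"
      by (auto simp: inj_on_def concat_gs)
    moreover have "distinct (concat (gs j))" using \<Phi>(1) by (simp add: concat_gs)
    ultimately have "card (Q j) * (\<Prod>g\<leftarrow>gs j. fact (length g)) = fact (length (concat (gs j)))"
      using card_permutes_incr[of "gs j" Min] unfolding Q_def set_gs by simp
    then have "of_nat (card (Q j)) * (of_nat (\<Prod>g\<leftarrow>gs j. fact (length g)) :: rat) =
        fact (length (concat (gs j)))"
      by (metis of_nat_fact of_nat_mult)
    moreover have "(of_nat (\<Prod>g\<leftarrow>hs. fact (length g)) :: rat) = (\<Prod>g\<leftarrow>hs. fact (length g))"
      for hs :: "nat set list list"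
      by (induction hs) simp_all
    \<comment> \<open>The splitting consists of the runs of the type, and the parts equal to
      \<open>j\<close> in a run are counted by its blocks of size \<open>j\<close>.\<close>
    moreover have "c_fact j (type_of \<Phi>) (map sum_list (chunks I (type_of \<Phi>))) =
        (\<Prod>g\<leftarrow>gs j. fact (length g))"
      unfolding c_fact_def
        splitting_eq[OF zero_notin_type_of[OF assms(1)] is_splitting_chunks]
      by (simp add: type_of_def chunks_map gs_def cnt comp_def)
    moreover have "(\<Prod>g\<leftarrow>gs j. fact (length g)) \<noteq> (0 :: rat)"
      by (auto simp: prod_list_zero_iff dest: sym)
    ultimately show ?thesis
      by (simp add: concat_gs type_of_def cnt eq_divide_eq)
  qed
  \<comment> \<open>Matches the ranges of the products: \<open>C_coeff\<close> runs up to the sum of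
    the parts, the group up to \<open>n\<close>.\<close>
  moreover have "sum_list (type_of \<Phi>) = n"
  proof -
    have "card (\<Union>(set \<Phi>)) = sum_list (map card \<Phi>)"
      by (rule card_Union_eq_sum_list) (use \<Phi>(1,2,4) in auto)
    then show ?thesis unfolding \<Phi>(3) type_of_def by simp
  qed
  ultimately show ?thesis unfolding C_coeff_def by (simp only: of_nat_prod)
qed

section \<open>Exchanging the sums over the group and over the merge sets\<close>

lemma sum_const_series: "(\<Sum>x\<in>A. f) = scale (of_nat (card A)) f"
  by (induction A rule: infinite_finite_induct)
    (auto simp: scale_def fun_eq_iff distrib_right)

theorem theorem11:
  fixes n :: nat and \<alpha> :: "nat list" and \<Phi> :: "nat set list"
  assumes "composition_of n \<alpha>" and "set_composition_of n \<Phi>" and "type_of \<Phi> = \<alpha>"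
  shows "P \<alpha> = (\<Sum>\<sigma> \<in> SG \<Phi>. rho (NP (act \<sigma> \<Phi>)))"
proof -
  let ?W = "Pow (weak_descents \<alpha>)" and ?m = "\<lambda>I. M (map sum_list (chunks I \<alpha>))"
  have fin: "finite (SG \<Phi>)"
    unfolding SG_def by (intro finite_PiE finite_permutations) (auto simp: blocks_of_size_def)
  have "finite (weak_descents \<alpha>)"
    by (rule finite_subset[of _ "{..<length \<alpha>}"]) (auto simp: weak_descents_def)
  then have finW: "finite ?W" by simp
  \<comment> \<open>Every sum is extended to all subsets of the weak descents of
    \<open>\<alpha>\<close>, a range independent of \<open>\<sigma>\<close>, so that the two sums
    can be exchanged.\<close>
  have "rho (NP (act \<sigma> \<Phi>)) = (\<Sum>I\<in>?W. if I \<subseteq> descents (act \<sigma> \<Phi>) then ?m I else 0)"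
    if "\<sigma> \<in> SG \<Phi>" for \<sigma>
  proof -
    note act = set_composition_of_act[OF assms(2) that]
    have "Pow (descents (act \<sigma> \<Phi>)) = {I \<in> ?W. I \<subseteq> descents (act \<sigma> \<Phi>)}"
      using descents_subset[of "act \<sigma> \<Phi>"] act(2) assms(3) by auto
    then show ?thesis
      by (simp only: rho_NP[OF act(1)] act(2) assms(3) sum.inter_filter[OF finW])
  qed
  then have "(\<Sum>\<sigma> \<in> SG \<Phi>. rho (NP (act \<sigma> \<Phi>))) =
      (\<Sum>\<sigma> \<in> SG \<Phi>. \<Sum>I\<in>?W. if I \<subseteq> descents (act \<sigma> \<Phi>) then ?m I else 0)"
    by (rule sum.cong[OF refl])
  also have "\<dots> = (\<Sum>I\<in>?W. \<Sum>\<sigma> \<in> SG \<Phi>. if I \<subseteq> descents (act \<sigma> \<Phi>) then ?m I else 0)"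
    by (rule sum.swap)
  also have "\<dots> = (\<Sum>I\<in>?W. scale (C_coeff \<alpha> (map sum_list (chunks I \<alpha>))) (?m I))"
  proof (rule sum.cong[OF refl])
    fix I assume "I \<in> ?W"
    then have "C_coeff \<alpha> (map sum_list (chunks I \<alpha>)) =
        of_nat (card {\<sigma> \<in> SG \<Phi>. I \<subseteq> descents (act \<sigma> \<Phi>)})"
      using card_SG_descents[OF assms(2), of I] assms(3) by simp
    moreover have "(\<Sum>\<sigma> \<in> SG \<Phi>. if I \<subseteq> descents (act \<sigma> \<Phi>) then ?m I else 0) =
        (\<Sum>\<sigma> \<in> {\<sigma> \<in> SG \<Phi>. I \<subseteq> descents (act \<sigma> \<Phi>)}. ?m I)"
      by (rule sum.inter_filter[OF fin, symmetric])
    ultimately show "(\<Sum>\<sigma> \<in> SG \<Phi>. if I \<subseteq> descents (act \<sigma> \<Phi>) then ?m I else 0) =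
        scale (C_coeff \<alpha> (map sum_list (chunks I \<alpha>))) (?m I)"
      by (simp only: sum_const_series)
  qed
  also have "\<dots> = P \<alpha>"
    using P_eq_sum_weak_descents[of \<alpha>] zero_notin_type_of[OF assms(2)] unfolding assms(3) by metis
  finally show ?thesis ..
qed

end
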